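(* Let $2\le n<d$ be integers and let $\Gamma=\langle M_{d;\alpha_0,\dots,\alpha_n}\rangle\subset \mathrm{GL}(n+1,\mathbb{K})$ be a cyclic group of order $d$ as in the context. Let $I_d=(m_1,\dots,m_{\mu_d})$ be the ideal generated by all monomial invariants of $\Gamma$ of degree $d$ and let $X_d\subset\mathbb{P}^{\mu_d-1}$ be the variety parameterized by $I_d$. Then the homogeneous ideal $\mathrm{I}(X_d)$ of $X_d$ is generated by quadrics and cubics; precisely, $\mathrm{I}(X_d)=\langle \mathcal{W}_{d,2},\mathcal{W}_{d,3}\rangle$.
   Context: $\mathbb{K}$ is an algebraically closed field of characteristic zero and $R=\mathbb{K}[x_0,\dots,x_n]$. Fix $e\in\mathbb{K}$ a primitive $d$-th root of $1$, and integers $0\le\alpha_0\le\cdots\le\alpha_n<d$ with $\mathrm{GCD}(d,\alpha_0,\dots,\alpha_n)=1$ and $\alpha_i<\alpha_j$ for some $i\ne j$. $M_{d;\alpha_0,\dots,\alpha_n}$ is the diagonal matrix $\mathrm{diag}(e^{\alpha_0},\dots,e^{\alpha_n})$, acting on $R$ by $x_i\mapsto e^{\alpha_i}x_i$; thus a monomial $x_0^{a_0}\cdots x_n^{a_n}$ is an invariant of $\Gamma$ iff $\alpha_0a_0+\cdots+\alpha_na_n\equiv 0 \pmod d$. The monomials $m_1,\dots,m_{\mu_d}$ are all the monomials of degree $d$ invariant under $\Gamma$. The morphism $\varphi_{I_d}:\mathbb{P}^n\to\mathbb{P}^{\mu_d-1}$ is given by $(m_1,\dots,m_{\mu_d})$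 and $X_d=\varphi_{I_d}(\mathbb{P}^n)$. Let $S=\mathbb{K}[w_1,\dots,w_{\mu_d}]$ be the (standard graded) coordinate ring of $\mathbb{P}^{\mu_d-1}$; $\mathrm{I}(X_d)\subset S$ is the kernel of the $\mathbb{K}$-algebra homomorphism $\rho:S\to R$, $\rho(w_i)=m_i$. For $k\ge 2$, $\mathcal{W}_{d,k}$ is the set of binomials $w_{i_1}\cdots w_{i_k}-w_{j_1}\cdots w_{j_k}\in S$ such that $m_{i_1}\cdots m_{i_k}=m_{j_1}\cdots m_{j_k}$. *)

theory Defs
  imports
    "HOL-Library.Poly_Mapping"
    "HOL-Computational_Algebra.Polynomial"
    "HOL-Algebra.Ideal"
    "HOL-Algebra.Generated_Groups"
    "Jordan_Normal_Form.Matrix"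
begin

text \<open>Polynomials over \<open>'k\<close> in variables indexed by \<open>nat\<close>: finitely supported maps from
  exponent vectors to coefficients. The ring with finitely many variables is carved out by
  its carrier in \<open>poly_ring\<close>.\<close>

type_synonym 'k mvpoly = "(nat \<Rightarrow>\<^sub>0 nat) \<Rightarrow>\<^sub>0 'k"

definition Var :: "nat \<Rightarrow> 'k::comm_ring_1 mvpoly" where
  "Var i = Poly_Mapping.single (Poly_Mapping.single i 1) 1"

definition Const :: "'k::comm_ring_1 \<Rightarrow> 'k mvpoly" where
  "Const c = Poly_Mapping.single 0 c"

definition poly_ring :: "nat set \<Rightarrow> 'k::comm_ring_1 mvpoly ring" where
  "poly_ring V = \<lparr>carrier = {p. \<forall>t \<in> Poly_Mapping.keys p. Poly_Mapping.keys t \<subseteq> V},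
     monoid.mult = (*), one = 1, zero = 0, add = (+)\<rparr>"

text \<open>The \<open>'k\<close>-algebra homomorphism sending the \<open>i\<close>-th variable to \<open>f i\<close>.\<close>

definition subst :: "(nat \<Rightarrow> 'k mvpoly) \<Rightarrow> 'k::comm_ring_1 mvpoly \<Rightarrow> 'k mvpoly" where
  "subst f p = (\<Sum>t \<in> Poly_Mapping.keys p. Const (Poly_Mapping.lookup p t) *
     (\<Prod>i \<in> Poly_Mapping.keys t. f i ^ Poly_Mapping.lookup t i))"

lemma cring_poly_ring: "cring (poly_ring V :: 'k::comm_ring_1 mvpoly ring)" (is "cring ?S")
proof (rule cringI)
  show "abelian_group ?S"
  proof (rule abelian_groupI)
    fix p :: "'k mvpoly" assume "p \<in> carrier ?S"
    then show "\<exists>q \<in> carrier ?S. q \<oplus>\<^bsub>?S\<^esub> p = \<zero>\<^bsub>?S\<^esub>"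
      by (intro bexI[of _ "- p"]) (auto simp: poly_ring_def)
  qed (use keys_add in \<open>fastforce simp: poly_ring_def algebra_simps\<close>)+
  show "Group.comm_monoid ?S"
  proof (rule comm_monoidI)
    fix p q :: "'k mvpoly" assume pq: "p \<in> carrier ?S" "q \<in> carrier ?S"
    have "Poly_Mapping.keys t \<subseteq> V" if t: "t \<in> Poly_Mapping.keys (p * q)" for t
    proof -
      from keys_mult t obtain a b where
        "t = a + b" "a \<in> Poly_Mapping.keys p" "b \<in> Poly_Mapping.keys q" by blast
      with pq keys_add[of a b] show ?thesis by (fastforce simp: poly_ring_def)
    qed
    then show "p \<otimes>\<^bsub>?S\<^esub> q \<in> carrier ?S" by (auto simp: poly_ring_def)
  qed (auto simp: poly_ring_def algebra_simps)
qed (auto simp: poly_ring_def algebra_simps)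

definition primitive_root_of_unity :: "nat \<Rightarrow> 'k::field \<Rightarrow> bool" where
  "primitive_root_of_unity d e \<longleftrightarrow> 0 < d \<and> e ^ d = 1 \<and> (\<forall>k. 0 < k \<and> k < d \<longrightarrow> e ^ k \<noteq> 1)"

definition GL :: "nat \<Rightarrow> 'k::field mat monoid" where
  "GL N = units_of (ring_mat TYPE('k) N ())"

text \<open>The matrix \<open>M\<^bsub>d;\<alpha>\<^sub>0,\<dots>,\<alpha>\<^sub>n\<^esub>\<close>, for the root of unity \<open>e\<close> of order \<open>d\<close>; rows and columns
  are numbered \<open>0,\<dots>,n\<close>.\<close>

definition M_mat :: "nat \<Rightarrow> 'k::field \<Rightarrow> (nat \<Rightarrow> nat) \<Rightarrow> 'k mat" where
  "M_mat n e \<alpha> = mat_diag (Suc n) (\<lambda>i. e ^ \<alpha> i)"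

definition Gamma_group :: "nat \<Rightarrow> 'k::field \<Rightarrow> (nat \<Rightarrow> nat) \<Rightarrow> 'k mat set" where
  "Gamma_group n e \<alpha> = generate (GL (Suc n)) {M_mat n e \<alpha>}"

text \<open>Linear substitution; for a diagonal matrix, \<open>x\<^sub>i\<close> is multiplied by the \<open>i\<close>-th diagonal entry.\<close>

definition act :: "'k::field mat \<Rightarrow> 'k mvpoly \<Rightarrow> 'k mvpoly" where
  "act A = subst (\<lambda>i. \<Sum>j<dim_col A. Const (A $$ (i, j)) * Var j)"

definition monomials :: "nat \<Rightarrow> nat \<Rightarrow> 'k::comm_ring_1 mvpoly set" where
  "monomials n d = {\<Prod>i\<le>n. Var i ^ a i | a :: nat \<Rightarrow> nat. (\<Sum>i\<le>n. a i) = d}"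

definition invariant_monomials ::
  "nat \<Rightarrow> nat \<Rightarrow> 'k::field \<Rightarrow> (nat \<Rightarrow> nat) \<Rightarrow> 'k mvpoly set" where
  "invariant_monomials n d e \<alpha> = {f \<in> monomials n d. \<forall>A \<in> Gamma_group n e \<alpha>. act A f = f}"

text \<open>\<open>I(X\<^sub>d)\<close> for the variety \<open>X\<^sub>d\<close> parameterized by \<open>m\<^sub>1,\<dots>,m\<^sub>\<mu>\<close>: the kernel of
  \<open>\<rho> : K[w\<^sub>1,\<dots>,w\<^sub>\<mu>] \<rightarrow> K[x\<^sub>0,\<dots>,x\<^sub>n]\<close>, \<open>\<rho>(w\<^sub>i) = m\<^sub>i\<close>.\<close>

definition I_X :: "nat \<Rightarrow> nat \<Rightarrow> (nat \<Rightarrow> 'k::field mvpoly) \<Rightarrow> 'k mvpoly set" where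
  "I_X n \<mu> m = a_kernel (poly_ring {1..\<mu>}) (poly_ring {0..n}) (subst m)"

text \<open>The index tuples \<open>(i\<^sub>1,\<dots>,i\<^sub>k)\<close> and \<open>(j\<^sub>1,\<dots>,j\<^sub>k)\<close> are functions on \<open>{1..k}\<close>.\<close>

definition W_binomials :: "nat \<Rightarrow> (nat \<Rightarrow> 'k::field mvpoly) \<Rightarrow> nat \<Rightarrow> 'k mvpoly set" where
  "W_binomials \<mu> m k =
     {(\<Prod>t=1..k. Var (i t)) - (\<Prod>t=1..k. Var (j t)) | i j.
        i \<in> {1..k} \<rightarrow> {1..\<mu>} \<and> j \<in> {1..k} \<rightarrow> {1..\<mu>} \<and>
        (\<Prod>t=1..k. m (i t)) = (\<Prod>t=1..k. m (j t))}"

end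

theory Submission
  imports Defs "HOL-Number_Theory.Residues" "HOL-Library.FuncSet" "HOL-Library.Disjoint_Sets"
begin

text \<open>The kernel of a monomial map is spanned by the differences of monomials \<open>w\<^sup>s - w\<^sup>t\<close> with the
  same image. Let \<open>s\<close> and \<open>t\<close> have degree \<open>k \<ge> 4\<close> and common image \<open>T\<close>, a monomial of degree \<open>kd\<close>, and
  pick a variable \<open>w\<^sub>i\<close> of \<open>w\<^sup>s\<close> and a variable \<open>w\<^sub>j\<close> of \<open>w\<^sup>t\<close>. The cofactor of \<open>lcm(m\<^sub>i, m\<^sub>j)\<close> in \<open>T\<close>
  has degree at least \<open>(k - 2) d \<ge> 2 d - 1\<close>, so by the Erdos-Ginzburg-Ziv theorem it is divisible
  by some invariant \<open>m\<^sub>r\<close> of degree \<open>d\<close>. The same theorem factors the remaining invariants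
  \<open>T / (m\<^sub>i m\<^sub>r)\<close> and \<open>T / (m\<^sub>j m\<^sub>r)\<close> as images of monomials \<open>w\<^sup>a\<close> and \<open>w\<^sup>b\<close>. In the chain
  \<open>w\<^sup>s, w\<^sub>i w\<^sub>r w\<^sup>a, w\<^sub>j w\<^sub>r w\<^sup>b, w\<^sup>t\<close> consecutive monomials share a variable, so by induction
  their differences are generated in degree at most 3.\<close>

section \<open>The Erdos-Ginzburg-Ziv theorem\<close>

text \<open>Removing \<open>F\<close> matches these sets with the subsets of \<open>X - F\<close> of
  size \<open>k - card F\<close>. In the prime case below, this counts the index sets in which a
  given product of values occurs.\<close>

lemma card_subsets_between:
  assumes "finite X" "F \<subseteq> X" "card F \<le> k"
  shows "card {I. F \<subseteq> I \<and> I \<subseteq> X \<and> card I = k} = (card X - card F) choose (k - card F)"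
proof -
  have F: "finite F" using assms finite_subset by blast
  have "bij_betw (\<lambda>J. J \<union> F) {J. J \<subseteq> X - F \<and> card J = k - card F}
          {I. F \<subseteq> I \<and> I \<subseteq> X \<and> card I = k}"
  proof (rule bij_betwI[where g = "\<lambda>I. I - F"])
    show "(\<lambda>J. J \<union> F) \<in> {J. J \<subseteq> X - F \<and> card J = k - card F} \<rightarrow> {I. F \<subseteq> I \<and> I \<subseteq> X \<and> card I = k}"
    proof safe
      fix J assume J: "J \<subseteq> X - F" "card J = k - card F"
      then have "finite J" using assms(1) finite_subset by blast
      moreover have "J \<inter> F = {}" using J by blast
      ultimately show "card (J \<union> F) = k" using J F assms(3) by (simp add: card_Un_disjoint)
    qed (use assms in auto)
    show "(\<lambda>I. I - F) \<in> {I. F \<subseteq> I \<and> I \<subseteq> X \<and> card I = k} \<rightarrow> {J. J \<subseteq> X - F \<and> card J = k - card F}"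
      using F by (auto simp: card_Diff_subset)
  qed auto
  then have "card {J. J \<subseteq> X - F \<and> card J = k - card F} = card {I. F \<subseteq> I \<and> I \<subseteq> X \<and> card I = k}"
    by (rule bij_betw_same_card)
  moreover have "card {J. J \<subseteq> X - F \<and> card J = k - card F} = card (X - F) choose (k - card F)"
    using assms(1) by (intro n_subsets) auto
  ultimately show ?thesis using assms F by (simp add: card_Diff_subset)
qed

text \<open>The factorial of \<open>2 * p - 1 - r\<close> contains the factor \<open>p\<close>
  because \<open>r < p\<close>, whereas those of \<open>p - r\<close> and \<open>p - 1\<close> have
  only factors below \<open>p\<close>.\<close>

lemma prime_dvd_binomial_shift:
  fixes p r :: nat
  assumes "prime p" "1 \<le> r" "r < p"
  shows "p dvd ((2 * p - 1 - r) choose (p - r))"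
proof -
  have "fact (p - r) * fact (p - 1) * ((2 * p - 1 - r) choose (p - r)) = (fact (2 * p - 1 - r) :: nat)"
    using binomial_fact_lemma[of "p - r" "2 * p - 1 - r"] assms by simp
  moreover have "p dvd fact (2 * p - 1 - r)" using assms by (subst prime_dvd_fact_iff) auto
  moreover have "\<not> p dvd fact (p - r)" "\<not> p dvd fact (p - 1)"
    using assms prime_gt_0_nat[of p] by (auto simp: prime_dvd_fact_iff)
  ultimately show ?thesis using assms(1) by (metis prime_dvd_mult_iff)
qed

text \<open>Times the factorial of \<open>p - 1\<close>, the coefficient is the product of the
  numbers strictly between \<open>p\<close> and \<open>2 * p\<close>, none of which is a multiple of
  \<open>p\<close>.\<close>

lemma prime_not_dvd_binomial:
  fixes p :: nat
  assumes "prime p"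
  shows "\<not> p dvd ((2 * p - 1) choose p)"
proof
  assume dvd: "p dvd ((2 * p - 1) choose p)"
  have p: "p > 0" using assms prime_gt_0_nat by blast
  have "fact p * fact (p - 1) * ((2 * p - 1) choose p) = (fact (2 * p - 1) :: nat)"
    using binomial_fact_lemma[of p "2 * p - 1"] p by simp
  also have "\<dots> = fact p * \<Prod>{Suc p..2 * p - 1}"
    using p by (intro fact_eq_fact_times) simp
  finally have "fact (p - 1) * ((2 * p - 1) choose p) = \<Prod>{Suc p..2 * p - 1}"
    by simp
  then have "p dvd \<Prod>{Suc p..2 * p - 1}" using dvd by (metis dvd_mult)
  then obtain i where "i \<in> {Suc p..2 * p - 1}" "p dvd i"
    using assms by (auto simp: prime_dvd_prod_iff)
  then have "p dvd i - p" "0 < i - p" "i - p < p" by auto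
  then show False using dvd_imp_le by fastforce
qed

text \<open>If no \<open>p\<close>-subset had sum divisible by \<open>p\<close>, then by Fermat the \<open>(p-1)\<close>-st powers of the
  sums over all \<open>p\<close>-subsets would add up to a binomial coefficient prime to \<open>p\<close>; but expanding
  the powers, every product of values occurs a multiple of \<open>p\<close> times.\<close>

lemma erdos_ginzburg_ziv_prime:
  fixes a :: "'i \<Rightarrow> nat" and p :: nat
  assumes p: "prime p" and X: "finite X" "card X = 2 * p - 1"
  shows "\<exists>I\<subseteq>X. card I = p \<and> p dvd (\<Sum>i\<in>I. a i)"
proof (rule ccontr)
  assume neg: "\<not> ?thesis"
  define S where "S = {I. I \<subseteq> X \<and> card I = p}"
  define T where "T = {..<p - 1}"
  have p1: "p > 1" using p prime_gt_1_nat by blast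
  have finS: "finite S" unfolding S_def using X by simp
  have finI: "finite I" if "I \<in> S" for I using that X finite_subset by (auto simp: S_def)
  have "[(\<Sum>I\<in>S. (\<Sum>i\<in>I. a i) ^ (p - 1)) = (\<Sum>I\<in>S. 1)] (mod p)"
    using neg by (intro cong_sum fermat_theorem p) (auto simp: S_def)
  moreover have "(\<Sum>I\<in>S. 1) = (2 * p - 1) choose p"
    using n_subsets[OF X(1), of p] X(2) by (simp add: S_def)
  moreover have "p dvd (\<Sum>I\<in>S. (\<Sum>i\<in>I. a i) ^ (p - 1))"
  proof -
    \<comment> \<open>Padding with zeros makes the range of \<open>f\<close> independent of
      \<open>I\<close>, so that the two sums can be exchanged.\<close>
    have expand: "(\<Sum>i\<in>I. a i) ^ (p - 1) =
        (\<Sum>f\<in>T \<rightarrow>\<^sub>E X. if f ` T \<subseteq> I then (\<Prod>t\<in>T. a (f t)) else 0)" if I: "I \<in> S" for I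
    proof -
      have "(\<Sum>i\<in>I. a i) ^ (p - 1) = (\<Prod>t\<in>T. \<Sum>i\<in>I. a i)" by (simp add: T_def)
      also have "\<dots> = (\<Sum>f\<in>T \<rightarrow>\<^sub>E I. \<Prod>t\<in>T. a (f t))"
        using finI[OF I] by (intro prod_sum_PiE) (auto simp: T_def)
      also have "T \<rightarrow>\<^sub>E I = {f \<in> T \<rightarrow>\<^sub>E X. f ` T \<subseteq> I}"
        using I by (auto simp: S_def PiE_iff extensional_def)
      also have "(\<Sum>f\<in>{f \<in> T \<rightarrow>\<^sub>E X. f ` T \<subseteq> I}. \<Prod>t\<in>T. a (f t)) =
          (\<Sum>f\<in>T \<rightarrow>\<^sub>E X. if f ` T \<subseteq> I then (\<Prod>t\<in>T. a (f t)) else 0)"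
        using X by (intro sum.inter_filter) (auto simp: T_def intro: finite_PiE)
      finally show ?thesis .
    qed
    have "(\<Sum>I\<in>S. (\<Sum>i\<in>I. a i) ^ (p - 1)) =
        (\<Sum>I\<in>S. \<Sum>f\<in>T \<rightarrow>\<^sub>E X. if f ` T \<subseteq> I then (\<Prod>t\<in>T. a (f t)) else 0)"
      by (intro sum.cong refl expand)
    also have "\<dots> = (\<Sum>f\<in>T \<rightarrow>\<^sub>E X. \<Sum>I\<in>S. if f ` T \<subseteq> I then (\<Prod>t\<in>T. a (f t)) else 0)"
      by (rule sum.swap)
    also have "p dvd \<dots>"
    proof (rule dvd_sum)
      fix f assume f: "f \<in> T \<rightarrow>\<^sub>E X"
      have "(\<Sum>I\<in>S. if f ` T \<subseteq> I then (\<Prod>t\<in>T. a (f t)) else 0) =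
          card {I \<in> S. f ` T \<subseteq> I} * (\<Prod>t\<in>T. a (f t))"
        by (subst sum.inter_filter[symmetric]) (use finS in auto)
      moreover have "p dvd card {I \<in> S. f ` T \<subseteq> I}"
      proof -
        have sub: "f ` T \<subseteq> X" using f by auto
        \<comment> \<open>A product of \<open>p - 1\<close> values involves at least 1 and at most
          \<open>p - 1\<close> distinct indices, which is the range of \<open>r\<close> in
          \<open>prime_dvd_binomial_shift\<close>.\<close>
        have le: "card (f ` T) < p" using card_image_le[of T f] p1 by (simp add: T_def)
        have ge: "1 \<le> card (f ` T)" using p1 by (auto simp: T_def Suc_le_eq card_gt_0_iff lessThan_empty_iff)
        have "{I \<in> S. f ` T \<subseteq> I} = {I. f ` T \<subseteq> I \<and> I \<subseteq> X \<and> card I = p}"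
          by (auto simp: S_def)
        then have "card {I \<in> S. f ` T \<subseteq> I} = (2 * p - 1 - card (f ` T)) choose (p - card (f ` T))"
          using card_subsets_between[OF X(1) sub] le X(2) by simp
        then show ?thesis using prime_dvd_binomial_shift[OF p ge le] by simp
      qed
      ultimately show "p dvd (\<Sum>I\<in>S. if f ` T \<subseteq> I then (\<Prod>t\<in>T. a (f t)) else 0)" by simp
    qed
    finally show ?thesis .
  qed
  ultimately have "p dvd ((2 * p - 1) choose p)" by (metis cong_dvd_iff)
  then show False using prime_not_dvd_binomial[OF p] by simp
qed

text \<open>Greedy choice: once \<open>r\<close> sets are removed, at least
  \<open>(r + 2) * m - 1 - r * m = 2 * m - 1\<close> elements are left for the next one. The theorem
  for \<open>m\<close> is a hypothesis here so that an induction hypothesis can supply it.\<close>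

lemma disjoint_zero_sum_subsets:
  fixes a :: "'i \<Rightarrow> nat" and m :: nat
  assumes egz: "\<And>Y. finite Y \<Longrightarrow> card Y = 2 * m - 1 \<Longrightarrow> Y \<subseteq> X \<Longrightarrow> \<exists>I\<subseteq>Y. card I = m \<and> m dvd (\<Sum>i\<in>I. a i)"
    and X: "finite X" "(r + 1) * m - 1 \<le> card X" and m: "m > 0"
  shows "\<exists>F. (\<forall>j<r. F j \<subseteq> X \<and> card (F j) = m \<and> m dvd (\<Sum>i\<in>F j. a i)) \<and> disjoint_family_on F {..<r}"
  using X(2)
proof (induction r)
  case 0
  then show ?case by (auto simp: disjoint_family_on_def)
next
  case (Suc r)
  then have "(r + 1) * m - 1 \<le> card X" by simp
  with Suc.IH obtain F where F: "\<forall>j<r. F j \<subseteq> X \<and> card (F j) = m \<and> m dvd (\<Sum>i\<in>F j. a i)"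
    "disjoint_family_on F {..<r}"
    by blast
  define U where "U = (\<Union>j<r. F j)"
  have "card U \<le> (\<Sum>j<r. card (F j))" unfolding U_def by (rule card_UN_le) simp
  also have "\<dots> = r * m" using F by simp
  finally have "card U \<le> r * m" .
  moreover have U: "U \<subseteq> X" using F by (auto simp: U_def)
  ultimately have "2 * m - 1 \<le> card (X - U)"
    using Suc.prems X(1) m finite_subset[OF U X(1)] by (simp add: card_Diff_subset)
  then obtain Y where Y: "Y \<subseteq> X - U" "card Y = 2 * m - 1" "finite Y"
    by (meson obtain_subset_with_card_n)
  with egz[of Y] obtain I where I: "I \<subseteq> Y" "card I = m" "m dvd (\<Sum>i\<in>I. a i)" by auto
  define G where "G = F(r := I)"
  have "disjoint_family_on G {..<Suc r}"
  proof -
    have old_new: "F j \<inter> I = {}" if "j < r" for j using that I(1) Y(1) by (auto simp: U_def)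
    have old: "F i \<inter> F j = {}" if "i < r" "j < r" "i \<noteq> j" for i j
      using that F(2) by (simp add: disjoint_family_on_def)
    show ?thesis
      unfolding disjoint_family_on_def
    proof (intro ballI impI)
      fix i j assume ij: "i \<in> {..<Suc r}" "j \<in> {..<Suc r}" "i \<noteq> j"
      then consider "i = r" "j < r" | "j = r" "i < r" | "i < r" "j < r" by fastforce
      then show "G i \<inter> G j = {}"
        using old_new[of i] old_new[of j] old[of i j] ij(3)
        by cases (simp_all add: G_def Int_commute)
    qed
  qed
  moreover have "\<forall>j<Suc r. G j \<subseteq> X \<and> card (G j) = m \<and> m dvd (\<Sum>i\<in>G j. a i)"
    using F(1) I Y(1) by (auto simp: G_def less_Suc_eq)
  ultimately show ?case by blast
qed

text \<open>Induction on the prime factorization. Among \<open>2 * p * n - 1\<close> elements there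
  are \<open>2 * p - 1\<close> disjoint sets of size \<open>n\<close> with sums divisible by
  \<open>n\<close>. The prime case, applied to these sums divided by \<open>n\<close>, selects
  \<open>p\<close> of the sets, and their union is the required set.\<close>

theorem erdos_ginzburg_ziv:
  fixes a :: "'i \<Rightarrow> nat" and n :: nat
  assumes "n > 0" "finite X" "2 * n - 1 \<le> card X"
  shows "\<exists>I\<subseteq>X. card I = n \<and> n dvd (\<Sum>i\<in>I. a i)"
  using assms
proof (induction n arbitrary: X a rule: prime_divisors_induct)
  case zero
  then show ?case by simp
next
  case (unit n)
  then have "n = 1" by simp
  with unit.prems obtain x where "x \<in> X" by fastforce
  then show ?case using \<open>n = 1\<close> by (intro exI[of _ "{x}"]) simp
next
  case (factor p n)
  from \<open>p * n > 0\<close> have n: "n > 0" and p0: "p > 0" by auto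
  have p: "prime p" using factor by simp
  have "2 * p * n - 1 \<le> card X" using factor.prems by (simp add: mult.assoc)
  moreover have "(2 * p - 1 + 1) * n - 1 = 2 * p * n - 1" using p0 by simp
  ultimately have "(2 * p - 1 + 1) * n - 1 \<le> card X" by simp
  then obtain F where F: "\<And>j. j < 2 * p - 1 \<Longrightarrow> F j \<subseteq> X \<and> card (F j) = n \<and> n dvd (\<Sum>i\<in>F j. a i)"
    and disj: "disjoint_family_on F {..<2 * p - 1}"
    using disjoint_zero_sum_subsets[where X = X and a = a and m = n and r = "2 * p - 1",
        OF factor.IH[OF n] factor.prems(2) _ n] by auto
  obtain J where J: "J \<subseteq> {..<2 * p - 1}" "card J = p" "p dvd (\<Sum>j\<in>J. (\<Sum>i\<in>F j. a i) div n)"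
    using erdos_ginzburg_ziv_prime[OF p, of "{..<2 * p - 1}" "\<lambda>j. (\<Sum>i\<in>F j. a i) div n"] by auto
  define I where "I = (\<Union>j\<in>J. F j)"
  have finJ: "finite J" using J(1) finite_subset by blast
  have finF: "finite (F j)" if "j \<in> J" for j
    using that F[of j] J(1) factor.prems(2) finite_subset by blast
  have disjJ: "\<forall>i\<in>J. \<forall>j\<in>J. i \<noteq> j \<longrightarrow> F i \<inter> F j = {}"
    using disj J(1) unfolding disjoint_family_on_def by blast
  have "card I = (\<Sum>j\<in>J. card (F j))"
    unfolding I_def using finJ finF disjJ by (intro card_UN_disjoint) auto
  also have "\<dots> = p * n" using F J by (subst sum.cong[OF refl, of _ _ "\<lambda>_. n"]) auto
  finally have "card I = p * n" .
  moreover have "I \<subseteq> X" using F J(1) by (auto simp: I_def)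
  moreover have "p * n dvd (\<Sum>i\<in>I. a i)"
  proof -
    have "(\<Sum>i\<in>I. a i) = (\<Sum>j\<in>J. \<Sum>i\<in>F j. a i)"
      unfolding I_def using finJ finF disjJ by (intro sum.UNION_disjoint) auto
    also have "\<dots> = (\<Sum>j\<in>J. n * ((\<Sum>i\<in>F j. a i) div n))"
      using F J(1) by (intro sum.cong refl) (metis dvd_mult_div_cancel lessThan_iff subsetD)
    also have "\<dots> = n * (\<Sum>j\<in>J. (\<Sum>i\<in>F j. a i) div n)" by (simp add: sum_distrib_left)
    finally show ?thesis using J(3) by (simp add: mult.commute mult_dvd_mono)
  qed
  ultimately show ?case by blast
qed

section \<open>Monomials and substitution\<close>

abbreviation lookup :: "('a \<Rightarrow>\<^sub>0 'b::zero) \<Rightarrow> 'a \<Rightarrow> 'b" where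
  "lookup \<equiv> Poly_Mapping.lookup"

abbreviation keys :: "('a \<Rightarrow>\<^sub>0 'b::zero) \<Rightarrow> 'a set" where
  "keys \<equiv> Poly_Mapping.keys"

abbreviation mon :: "(nat \<Rightarrow>\<^sub>0 nat) \<Rightarrow> 'k::comm_ring_1 mvpoly" where
  "mon t \<equiv> Poly_Mapping.single t 1"

text \<open>The additive extension of \<open>f\<close> to exponent vectors: the total degree for \<open>f = 1\<close>, the weight
  for \<open>f = \<alpha>\<close>, and the exponent of the image of \<open>w\<^sup>t\<close> when \<open>f i\<close> is the exponent of \<open>m\<^sub>i\<close>. In the
  last case \<open>of_nat k * u\<close> is \<open>k u\<close>, since \<open>of_nat k\<close> is concentrated in degree 0.\<close>

definition lin :: "(nat \<Rightarrow> 'a::comm_semiring_1) \<Rightarrow> (nat \<Rightarrow>\<^sub>0 nat) \<Rightarrow> 'a" where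
  "lin f t = (\<Sum>i\<in>keys t. of_nat (lookup t i) * f i)"

lemma lin_eq:
  assumes "finite V" "keys t \<subseteq> V"
  shows "lin f t = (\<Sum>i\<in>V. of_nat (lookup t i) * f i)"
  unfolding lin_def using assms by (intro sum.mono_neutral_left) (auto simp: in_keys_iff)

lemma lin_0 [simp]: "lin f 0 = 0"
  by (simp add: lin_def)

lemma lin_single [simp]: "lin f (Poly_Mapping.single i k) = of_nat k * f i"
  by (simp add: lin_def)

lemma lin_add [simp]: "lin f (s + t) = lin f s + lin f t"
proof -
  have "keys (s + t) \<subseteq> keys s \<union> keys t" by (rule keys_add)
  then show ?thesis
    by (simp add: lin_eq[of "keys s \<union> keys t"] lookup_add sum.distrib distrib_right)
qed

lemma keys_add_nat [simp]: "keys (s + t :: 'a \<Rightarrow>\<^sub>0 nat) = keys s \<union> keys t"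
  by (auto simp: in_keys_iff lookup_add)

text \<open>Induction on the total degree, one variable at a time; it reduces multiplicative
  identities for monomials to single variables.\<close>

lemma mon_induct [case_names zero add]:
  fixes t :: "'a \<Rightarrow>\<^sub>0 nat"
  assumes "P 0" "\<And>i t. P t \<Longrightarrow> P (Poly_Mapping.single i 1 + t)"
  shows "P t"
proof (induction "\<Sum>i\<in>keys t. lookup t i" arbitrary: t rule: less_induct)
  case less
  show ?case
  proof (cases "t = 0")
    case False
    then obtain i where i: "i \<in> keys t" by (meson all_not_in_conv keys_eq_empty)
    define s where "s = t - Poly_Mapping.single i 1"
    \<comment> \<open>The truncated subtraction is exact because the exponent of \<open>i\<close> in
      \<open>t\<close> is positive.\<close>
    have t: "t = Poly_Mapping.single i 1 + s"
      using i by (intro poly_mapping_eqI)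
        (auto simp: s_def lookup_add lookup_minus lookup_single in_keys_iff when_def)
    have "(\<Sum>j\<in>keys s. lookup s j) = (\<Sum>j\<in>keys t. lookup s j)"
      using t by (intro sum.mono_neutral_left) (auto simp: in_keys_iff lookup_add)
    also have "\<dots> < (\<Sum>j\<in>keys t. lookup t j)"
      using i by (intro sum_strict_mono_ex1) (auto simp: t lookup_add)
    finally show ?thesis using assms(2)[OF less] t by simp
  qed (use assms in simp)
qed

lemma nonzero_eq_single_add:
  fixes t :: "'a \<Rightarrow>\<^sub>0 nat"
  assumes "t \<noteq> 0"
  shows "\<exists>i s. t = Poly_Mapping.single i 1 + s"
  using assms by (induction t rule: mon_induct) auto

lemma mon_add: "mon (s + t) = (mon s * mon t :: 'k::comm_ring_1 mvpoly)"
  by (simp add: mult_single)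

lemma Var_power: "(Var i :: 'k::comm_ring_1 mvpoly) ^ k = mon (Poly_Mapping.single i k)"
  by (induction k) (simp_all add: Var_def mult_single flip: single_add)

lemma mon_sum: "mon (\<Sum>i\<in>A. f i) = (\<Prod>i\<in>A. mon (f i) :: 'k::comm_ring_1 mvpoly)"
  by (induction A rule: infinite_finite_induct) (simp_all add: mon_add)

lemma inj_mon [simp]: "(mon s :: 'k::comm_ring_1 mvpoly) = mon t \<longleftrightarrow> s = t"
  by (auto simp: poly_mapping_eq_iff lookup_single when_def fun_eq_iff split: if_splits)

lemma poly_eq_sum_single:
  fixes p :: "'a \<Rightarrow>\<^sub>0 'b::comm_monoid_add"
  shows "p = (\<Sum>t\<in>keys p. Poly_Mapping.single t (lookup p t))"
  by (rule poly_mapping_eqI)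
    (auto simp: lookup_sum lookup_single when_def sum.delta in_keys_iff)

lemma poly_induct [case_names single add]:
  fixes p :: "'a \<Rightarrow>\<^sub>0 'b::comm_monoid_add"
  assumes "\<And>t c. P (Poly_Mapping.single t c)" "\<And>p q. P p \<Longrightarrow> P q \<Longrightarrow> P (p + q)"
  shows "P p"
proof -
  have "P (\<Sum>t\<in>A. Poly_Mapping.single t (lookup p t))" if "finite A" for A
    \<comment> \<open>The instance with coefficient 0 provides \<open>P 0\<close> for the empty
      sum.\<close>
    using that by induction (use assms(1)[of undefined 0] in \<open>auto intro: assms\<close>)
  then show ?thesis using poly_eq_sum_single[of p] finite_keys[of p] by metis
qed

text \<open>Values lie in any commutative monoid: polynomials when substituting for variables,
  scalars when a diagonal matrix acts.\<close>

definition eval_mon :: "(nat \<Rightarrow> 'a::comm_monoid_mult) \<Rightarrow> (nat \<Rightarrow>\<^sub>0 nat) \<Rightarrow> 'a" where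
  "eval_mon f t = (\<Prod>i\<in>keys t. f i ^ lookup t i)"

lemma eval_mon_eq:
  assumes "finite V" "keys t \<subseteq> V"
  shows "eval_mon f t = (\<Prod>i\<in>V. f i ^ lookup t i)"
  unfolding eval_mon_def using assms by (intro prod.mono_neutral_left) (auto simp: in_keys_iff)

lemma eval_mon_0 [simp]: "eval_mon f 0 = 1"
  by (simp add: eval_mon_def)

lemma eval_mon_single [simp]: "eval_mon f (Poly_Mapping.single i k) = f i ^ k"
  by (simp add: eval_mon_def)

lemma eval_mon_add [simp]: "eval_mon f (s + t) = eval_mon f s * eval_mon f t"
  by (simp add: eval_mon_eq[of "keys s \<union> keys t"] lookup_add prod.distrib power_add)

section \<open>Substitution as an algebra homomorphism\<close>

lemma Const_0 [simp]: "Const 0 = 0"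
  and Const_1 [simp]: "Const 1 = 1"
  and Const_add: "Const (a + b) = Const a + Const b"
  and Const_mult: "Const (a * b) = Const a * Const b"
  by (simp_all add: Const_def single_add mult_single)

lemma Const_mult_mon: "Const c * mon t = Poly_Mapping.single t c"
  by (simp add: Const_def mult_single)

lemma subst_eq:
  assumes "finite A" "keys p \<subseteq> A"
  shows "subst f p = (\<Sum>t\<in>A. Const (lookup p t) * eval_mon f t)"
  unfolding subst_def eval_mon_def using assms
  by (intro sum.mono_neutral_left) (auto simp: in_keys_iff)

lemma subst_0 [simp]: "subst f 0 = 0"
  by (simp add: subst_def)

lemma subst_single: "subst f (Poly_Mapping.single t c) = Const c * eval_mon f t"
  by (subst subst_eq[of "{t}"]) auto

lemma subst_1 [simp]: "subst f 1 = 1"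
  using subst_single[of f 0 1] by simp

lemma subst_add: "subst f (p + q) = subst f p + subst f q"
proof -
  have "keys (p + q) \<subseteq> keys p \<union> keys q" by (rule keys_add)
  then show ?thesis
    by (simp add: subst_eq[of "keys p \<union> keys q"] lookup_add Const_add sum.distrib distrib_right)
qed

text \<open>Both sides are additive in each factor, so comparing single terms is enough.\<close>

lemma subst_mult: "subst f (p * q) = subst f p * subst f q"
proof (induction p rule: poly_induct)
  case (single s c)
  show ?case
  proof (induction q rule: poly_induct)
    case (single t c')
    show ?case by (simp add: mult_single subst_single Const_mult ac_simps)
  qed (simp add: subst_add distrib_left)
qed (simp add: subst_add distrib_right)

lemma subst_prod_Var: "subst f (\<Prod>x\<in>A. Var (i x)) = (\<Prod>x\<in>A. f (i x))"
proof (induction A rule: infinite_finite_induct)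
  case (insert x A)
  have "subst f (Var (i x)) = f (i x)" by (simp add: Var_def subst_single)
  with insert show ?case by (simp add: subst_mult)
qed simp_all

lemma subst_uminus: "subst f (- p) = - subst f p"
  using subst_add[of f p "- p"] by (simp add: eq_neg_iff_add_eq_0 add.commute)

lemma subst_diff: "subst f (p - q) = subst f p - subst f q"
  using subst_add[of f p "- q"] by (simp add: subst_uminus)

lemma eval_mon_mon:
  assumes "\<And>i. i \<in> keys t \<Longrightarrow> m i = (mon (E i) :: 'k::comm_ring_1 mvpoly)"
  shows "eval_mon m t = mon (lin E t)"
  using assms
proof (induction t rule: mon_induct)
  case (add i t)
  then have "m i = mon (E i)" "eval_mon m t = mon (lin E t)" by auto
  then show ?case by (simp add: mon_add)
qed simp

text \<open>If variables go to monomials, terms go to terms with the same coefficient, so the kernel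
  of the substitution is governed by the fibres of \<open>lin E\<close>.\<close>

lemma subst_single_mon:
  assumes "\<And>i. i \<in> keys t \<Longrightarrow> m i = (mon (E i) :: 'k::comm_ring_1 mvpoly)"
  shows "subst m (Poly_Mapping.single t c) = Poly_Mapping.single (lin E t) c"
  using eval_mon_mon[of t m E] assms by (simp add: subst_single Const_mult_mon)

section \<open>Polynomial rings and their ideals as algebraic structures\<close>

lemma poly_ring_simps [simp]:
  "\<zero>\<^bsub>poly_ring V\<^esub> = 0" "\<one>\<^bsub>poly_ring V\<^esub> = 1"
  "x \<oplus>\<^bsub>poly_ring V\<^esub> y = x + y" "x \<otimes>\<^bsub>poly_ring V\<^esub> y = x * y"
  by (simp_all add: poly_ring_def)

lemma mon_in_poly_ring: "keys t \<subseteq> V \<Longrightarrow> Poly_Mapping.single t c \<in> carrier (poly_ring V)"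
  by (auto simp: poly_ring_def split: if_splits)

lemma poly_ring_uminus: "p \<in> carrier (poly_ring V) \<Longrightarrow> \<ominus>\<^bsub>poly_ring V\<^esub> p = - p"
  (is "_ \<Longrightarrow> \<ominus>\<^bsub>?S\<^esub> p = _")
proof -
  assume p: "p \<in> carrier ?S"
  interpret cring ?S by (rule cring_poly_ring)
  show ?thesis
    by (rule minus_equality) (use p in \<open>auto simp: poly_ring_def\<close>)
qed

lemma poly_ring_idealD:
  assumes "ideal J (poly_ring V)"
  shows "0 \<in> J" "\<And>p q. p \<in> J \<Longrightarrow> q \<in> J \<Longrightarrow> p + q \<in> J"
    "\<And>c p. c \<in> carrier (poly_ring V) \<Longrightarrow> p \<in> J \<Longrightarrow> c * p \<in> J"
  using additive_subgroup.zero_closed[OF ideal.axioms(1)[OF assms]]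
    additive_subgroup.a_closed[OF ideal.axioms(1)[OF assms]] ideal.I_l_closed[OF assms]
  by simp_all

lemma ideal_subst_kernel: "ideal (a_kernel (poly_ring V) (poly_ring V') (subst f)) (poly_ring V)"
  (is "ideal ?I ?S")
proof -
  interpret cring ?S by (rule cring_poly_ring)
  have mem: "p \<in> ?I \<longleftrightarrow> p \<in> carrier ?S \<and> subst f p = 0" for p
    by (simp add: a_kernel_def kernel_def)
  show ?thesis
  proof (rule idealI)
    show "subgroup ?I (add_monoid ?S)"
    proof (rule add.subgroupI)
      show "\<ominus>\<^bsub>?S\<^esub> p \<in> ?I" if "p \<in> ?I" for p
        using that a_inv_closed[of p] poly_ring_uminus[of p V] by (simp add: mem subst_uminus)
      show "p \<oplus>\<^bsub>?S\<^esub> q \<in> ?I" if "p \<in> ?I" "q \<in> ?I" for p q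
        using that a_closed[of p q] by (simp add: mem subst_add)
      show "?I \<noteq> {}" using mem zero_closed by force
    qed (auto simp: mem)
  next
    fix p q assume "p \<in> ?I" "q \<in> carrier ?S"
    then show "q \<otimes>\<^bsub>?S\<^esub> p \<in> ?I" "p \<otimes>\<^bsub>?S\<^esub> q \<in> ?I"
      using m_closed[of p q] m_closed[of q p] by (simp_all add: mem subst_mult)
  qed (rule ring_axioms)
qed

section \<open>Monomial invariants of the cyclic group\<close>

abbreviation tdeg :: "(nat \<Rightarrow>\<^sub>0 nat) \<Rightarrow> nat" where
  "tdeg \<equiv> lin (\<lambda>_. Suc 0)"

text \<open>Exponent functions are arbitrary beyond \<open>n\<close>, so many of them give the same
  monomial; finitely supported vectors with keys in \<open>{0..n}\<close> represent each monomial
  once.\<close>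

lemma monomials_eq:
  "(monomials n d :: 'k::comm_ring_1 mvpoly set) = mon ` {u. keys u \<subseteq> {0..n} \<and> tdeg u = d}"
proof -
  have mon_prod: "(\<Prod>i\<le>n. Var i ^ a i :: 'k mvpoly) = mon (\<Sum>i\<le>n. Poly_Mapping.single i (a i))"
    for a by (simp add: Var_power mon_sum)
  have lookup: "lookup (\<Sum>i\<le>n. Poly_Mapping.single i (a i)) j = (if j \<le> n then a j else 0)"
    for a :: "nat \<Rightarrow> nat" and j
    by (simp add: lookup_sum lookup_single when_def)
  have tdeg: "tdeg u = (\<Sum>i\<le>n. lookup u i)" if "keys u \<subseteq> {0..n}" for u
    using lin_eq[of "{..n}" u "\<lambda>_. Suc 0"] that by (simp add: atLeast0AtMost)
  have keys: "keys (\<Sum>i\<le>n. Poly_Mapping.single i (a i)) \<subseteq> {0..n}" for a :: "nat \<Rightarrow> nat"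
    by (auto simp: in_keys_iff lookup split: if_splits)
  show ?thesis
  proof (intro equalityI subsetI)
    fix f :: "'k mvpoly" assume "f \<in> monomials n d"
    then obtain a where a: "f = (\<Prod>i\<le>n. Var i ^ a i)" "(\<Sum>i\<le>n. a i) = d"
      by (auto simp: monomials_def)
    then show "f \<in> mon ` {u. keys u \<subseteq> {0..n} \<and> tdeg u = d}"
      unfolding a(1) mon_prod by (intro imageI CollectI conjI keys) (simp add: tdeg[OF keys] lookup)
  next
    fix f :: "'k mvpoly" assume "f \<in> mon ` {u. keys u \<subseteq> {0..n} \<and> tdeg u = d}"
    then obtain u where u: "f = mon u" "keys u \<subseteq> {0..n}" "tdeg u = d" by auto
    have "(\<Sum>i\<le>n. Poly_Mapping.single i (lookup u i)) = u"
      using u(2) by (intro poly_mapping_eqI) (auto simp: lookup in_keys_iff)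
    then have "f = (\<Prod>i\<le>n. Var i ^ lookup u i)" using u(1) mon_prod[of "lookup u"] by simp
    then show "f \<in> monomials n d" using u(3) tdeg[OF u(2)] by (auto simp: monomials_def)
  qed
qed

text \<open>Each linear form substituted for a variable collapses to one term, so the monomial is
  scaled by its own value at the diagonal entries.\<close>

lemma act_mat_diag:
  fixes c :: "nat \<Rightarrow> 'k::field"
  assumes "keys u \<subseteq> {0..n}"
  shows "act (mat_diag (Suc n) c) (mon u) = Poly_Mapping.single u (eval_mon c u)"
proof -
  let ?f = "\<lambda>i. \<Sum>j<dim_col (mat_diag (Suc n) c). Const (mat_diag (Suc n) c $$ (i, j)) * Var j"
  have f: "?f i = Const (c i) * Var i" if "i \<in> {0..n}" for i
  proof -
    have "?f i = (\<Sum>j<Suc n. if i = j then Const (c j) * Var j else 0)"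
      using that by (intro sum.cong) (auto simp: mat_diag_def)
    then show ?thesis using that by simp
  qed
  have "eval_mon ?f u = Poly_Mapping.single u (eval_mon c u)"
    using assms
  proof (induction u rule: mon_induct)
    case (add i u)
    then have "i \<in> {0..n}" by simp
    with add f[of i] show ?case by (simp add: Const_def Var_def mult_single)
  qed simp
  then show ?thesis by (simp add: act_def subst_single)
qed

lemma eval_mon_power: "eval_mon (\<lambda>i. x ^ a i) u = x ^ lin a u"
  by (induction u rule: mon_induct) (simp_all add: power_add)

lemma eval_mon_inverse:
  "eval_mon (\<lambda>i. inverse (c i)) u = inverse (eval_mon c u :: 'k::field)"
  by (induction u rule: mon_induct) (simp_all add: field_simps)

lemma eval_mon_mult: "eval_mon (\<lambda>i. b i * c i) u = eval_mon b u * eval_mon c u"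
  by (induction u rule: mon_induct) (simp_all add: ac_simps)

lemma primitive_root_power_eq_1_iff:
  assumes "primitive_root_of_unity d e"
  shows "e ^ k = 1 \<longleftrightarrow> d dvd k"
proof
  have d: "0 < d" "e ^ d = 1" and min: "\<And>k. 0 < k \<Longrightarrow> k < d \<Longrightarrow> e ^ k \<noteq> 1"
    using assms by (auto simp: primitive_root_of_unity_def)
  have "e ^ k = e ^ (d * (k div d) + k mod d)" by simp
  also have "\<dots> = e ^ (k mod d)" by (simp only: power_add power_mult d(2)) simp
  finally have eq: "e ^ k = e ^ (k mod d)" .
  assume "e ^ k = 1"
  then have "k mod d = 0" using eq min[of "k mod d"] d(1) by fastforce
  then show "d dvd k" by auto
next
  assume "d dvd k"
  then show "e ^ k = 1" using assms by (auto simp: primitive_root_of_unity_def power_mult)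
qed

text \<open>Being diagonal with entries at which the monomial takes the value 1 holds for the
  generator and passes to inverses and products, hence to the whole group.\<close>

lemma Gamma_group_diagonal:
  fixes e :: "'k::field"
  assumes "e \<noteq> 0" "e ^ lin \<alpha> u = 1" "A \<in> Gamma_group n e \<alpha>"
  shows "\<exists>c. A = mat_diag (Suc n) c \<and> eval_mon c u = 1"
proof -
  interpret R: ring "ring_mat TYPE('k) (Suc n) ()" by (rule ring_mat)
  interpret G: group "GL (Suc n) :: 'k mat monoid" unfolding GL_def by (rule R.units_group)
  have mult: "x \<otimes>\<^bsub>GL (Suc n)\<^esub> y = x * y" and one: "\<one>\<^bsub>GL (Suc n)\<^esub> = (1\<^sub>m (Suc n) :: 'k mat)"
    for x y :: "'k mat"
    by (simp_all add: GL_def units_of_def ring_mat_simps)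
  have GL: "mat_diag (Suc n) c \<in> carrier (GL (Suc n))" if "\<And>i. c i \<noteq> 0" for c :: "nat \<Rightarrow> 'k"
    using that unfolding GL_def units_of_def Units_def
    by (auto simp: ring_mat_simps intro!: bexI[of _ "mat_diag (Suc n) (\<lambda>i. inverse (c i))"])
  \<comment> \<open>\<open>generate\<close> also adjoins the inverse of the generator, which must be
    known explicitly to be seen as diagonal.\<close>
  have M_inv: "inv\<^bsub>GL (Suc n)\<^esub> (M_mat n e \<alpha>) = mat_diag (Suc n) (\<lambda>i. inverse (e ^ \<alpha> i))"
    using assms(1) by (intro G.inv_equality) (auto simp: M_mat_def mult one GL)
  from assms(3)[unfolded Gamma_group_def] show ?thesis
  proof (induction A rule: generate.induct)
    case one
    show ?case by (rule exI[of _ "\<lambda>_. 1"]) (simp add: \<open>\<one>\<^bsub>GL (Suc n)\<^esub> = _\<close> eval_mon_def)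
  next
    case (incl A)
    then show ?case using assms(2) by (auto simp: M_mat_def eval_mon_power)
  next
    case (inv A)
    then show ?case using assms(2) M_inv
      by (intro exI[of _ "\<lambda>i. inverse (e ^ \<alpha> i)"]) (simp add: eval_mon_inverse eval_mon_power)
  next
    case (eng A B)
    then obtain b c where "A = mat_diag (Suc n) b" "B = mat_diag (Suc n) c"
      "eval_mon b u = 1" "eval_mon c u = 1" by auto
    then show ?case
      by (intro exI[of _ "\<lambda>i. b i * c i"]) (simp add: mult eval_mon_mult)
  qed
qed

text \<open>The generator scales the monomial with exponent \<open>u\<close> by
  \<open>e ^ lin \<alpha> u\<close>, which is 1 exactly when \<open>d\<close> divides the weight;
  the other group elements then fix it too.\<close>

lemma invariant_monomials_eq:
  fixes e :: "'k::field"
  assumes e: "primitive_root_of_unity d e"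
  shows "invariant_monomials n d e \<alpha> =
    mon ` {u. keys u \<subseteq> {0..n} \<and> tdeg u = d \<and> d dvd lin \<alpha> u}"
proof -
  have "e \<noteq> 0" using e by (auto simp: primitive_root_of_unity_def zero_power)
  have "(\<forall>A\<in>Gamma_group n e \<alpha>. act A (mon u) = mon u) \<longleftrightarrow> d dvd lin \<alpha> u"
    if u: "keys u \<subseteq> {0..n}" for u
  proof
    assume "\<forall>A\<in>Gamma_group n e \<alpha>. act A (mon u) = mon u"
    moreover have "M_mat n e \<alpha> \<in> Gamma_group n e \<alpha>"
      unfolding Gamma_group_def by (rule generate.incl) simp
    ultimately have "Poly_Mapping.single u (eval_mon (\<lambda>i. e ^ \<alpha> i) u) = mon u"
      using act_mat_diag[OF u, of "\<lambda>i. e ^ \<alpha> i"] by (simp add: M_mat_def)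
    then have "e ^ lin \<alpha> u = 1" by (metis eval_mon_power lookup_single_eq)
    then show "d dvd lin \<alpha> u" using primitive_root_power_eq_1_iff[OF e] by simp
  next
    assume "d dvd lin \<alpha> u"
    then have "e ^ lin \<alpha> u = 1" using primitive_root_power_eq_1_iff[OF e] by simp
    then show "\<forall>A\<in>Gamma_group n e \<alpha>. act A (mon u) = mon u"
      using Gamma_group_diagonal[OF \<open>e \<noteq> 0\<close>] act_mat_diag[OF u] by metis
  qed
  then show ?thesis
    unfolding invariant_monomials_def monomials_eq by auto
qed

section \<open>Connecting factorizations of a monomial\<close>

lemma lin_sum: "lin f (\<Sum>x\<in>A. g x) = (\<Sum>x\<in>A. lin f (g x))"
  by (induction A rule: infinite_finite_induct) simp_all

lemma tdeg_eq_0_iff: "tdeg t = 0 \<longleftrightarrow> t = 0"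
  by (auto simp: lin_def in_keys_iff simp flip: keys_eq_empty)

text \<open>Erdos-Ginzburg-Ziv for the variables of a monomial, counted with multiplicity and
  weighted by \<open>\<alpha>\<close>.\<close>

lemma obtain_zero_sum_divisor:
  fixes \<alpha> :: "nat \<Rightarrow> nat"
  assumes "d > 0" "2 * d - 1 \<le> tdeg u"
  obtains r s where "u = r + s" "tdeg r = d" "d dvd lin \<alpha> r"
proof -
  \<comment> \<open>One element for each occurrence of a variable, so that subsets of
    \<open>X\<close> give divisors of the monomial.\<close>
  define X where "X = (SIGMA i:keys u. {..<lookup u i})"
  have "finite X" "card X = tdeg u" by (simp_all add: X_def lin_def)
  with erdos_ginzburg_ziv[of d X "\<lambda>x. \<alpha> (fst x)"] assms
  obtain I where I: "I \<subseteq> X" "card I = d" "d dvd (\<Sum>x\<in>I. \<alpha> (fst x))" by auto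
  have finI: "finite I" using I(1) \<open>finite X\<close> finite_subset by blast
  define r where "r = (\<Sum>x\<in>I. Poly_Mapping.single (fst x) (1::nat))"
  have "lookup r i \<le> lookup u i" for i
  proof -
    have "lookup r i = (\<Sum>x\<in>I. if fst x = i then Suc 0 else 0)"
      by (simp add: r_def lookup_sum lookup_single when_def)
    also have "\<dots> = card {x \<in> I. fst x = i}"
      using finI by (subst sum.inter_filter[symmetric]) auto
    also have "\<dots> \<le> card (Pair i ` {..<lookup u i})"
      using I(1) by (intro card_mono) (auto simp: X_def)
    also have "\<dots> \<le> lookup u i" using card_image_le[of "{..<lookup u i}" "Pair i"] by simp
    finally show ?thesis .
  qed
  then have "u = r + (u - r)"
    by (intro poly_mapping_eqI) (simp add: lookup_add lookup_minus)
  moreover have "tdeg r = d" "lin \<alpha> r = (\<Sum>x\<in>I. \<alpha> (fst x))"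
    using I(2) by (simp_all add: r_def lin_sum)
  ultimately show thesis using that I(3) by metis
qed

text \<open>The least common multiple of two divisors of degree \<open>d\<close> has degree at most \<open>2d\<close>, which
  leaves a cofactor large enough for the Erdos-Ginzburg-Ziv theorem.\<close>

lemma obtain_common_zero_sum_divisor:
  fixes \<alpha> :: "nat \<Rightarrow> nat"
  assumes "d > 0" and T: "P + P' = Q + Q'" and "tdeg P = d" "tdeg Q = d" "4 * d - 1 \<le> tdeg (P + P')"
  obtains r x y where "tdeg r = d" "d dvd lin \<alpha> r" "P' = r + x" "Q' = r + y"
proof -
  \<comment> \<open>With truncated subtraction, \<open>P + (Q - P)\<close> is the exponent of the
    least common multiple, and \<open>u\<close> is that of its cofactor.\<close>
  define u where "u = P' - (Q - P)"
  have T': "lookup P i + lookup P' i = lookup Q i + lookup Q' i" for i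
    using T by (metis lookup_add)
  have P': "P' = u + (Q - P)" and Q': "Q' = u + (P - Q)"
  proof -
    show "P' = u + (Q - P)"
    proof (rule poly_mapping_eqI)
      show "lookup P' i = lookup (u + (Q - P)) i" for i
        using T'[of i] by (simp add: u_def lookup_add lookup_minus)
    qed
    show "Q' = u + (P - Q)"
    proof (rule poly_mapping_eqI)
      show "lookup Q' i = lookup (u + (P - Q)) i" for i
        using T'[of i] by (simp add: u_def lookup_add lookup_minus)
    qed
  qed
  have "Q = (Q - P) + (Q - (Q - P))"
    by (intro poly_mapping_eqI) (simp add: lookup_add lookup_minus)
  then have "tdeg (Q - P) \<le> d" using \<open>tdeg Q = d\<close> by (metis le_add1 lin_add)
  \<comment> \<open>The degree of \<open>P'\<close> is at least \<open>3 * d - 1\<close>, and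
    removing \<open>Q - P\<close> costs at most \<open>d\<close>.\<close>
  then have "2 * d - 1 \<le> tdeg u" using assms(3,5) unfolding P' lin_add by linarith
  then obtain r s where "u = r + s" "tdeg r = d" "d dvd lin \<alpha> r"
    using obtain_zero_sum_divisor \<open>d > 0\<close> by blast
  then show thesis using that[of r "s + (Q - P)" "s + (P - Q)"] P' Q' by (simp add: add.assoc)
qed

text \<open>Passes from exponent vectors to the index tuples in which \<open>W_binomials\<close> is
  stated.\<close>

lemma mon_eq_prod_Var:
  "\<exists>i \<in> {1..tdeg t} \<rightarrow> keys t. (mon t :: 'k::comm_ring_1 mvpoly) = (\<Prod>x=1..tdeg t. Var (i x))"
proof (induction t rule: mon_induct)
  case (add j t)
  then obtain i where i: "i \<in> {1..tdeg t} \<rightarrow> keys t" "(mon t :: 'k mvpoly) = (\<Prod>x=1..tdeg t. Var (i x))"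
    by blast
  define i' where "i' = i(Suc (tdeg t) := j)"
  have "(\<Prod>x=1..tdeg t. Var (i' x) :: 'k mvpoly) = (\<Prod>x=1..tdeg t. Var (i x))"
    by (intro prod.cong) (auto simp: i'_def)
  then have "mon (Poly_Mapping.single j 1 + t) = (\<Prod>x=1..Suc (tdeg t). Var (i' x) :: 'k mvpoly)"
    using i(2) by (simp add: mon_add Var_def i'_def)
  moreover have "i' \<in> {1..Suc (tdeg t)} \<rightarrow> insert j (keys t)"
    using i(1) by (auto simp: i'_def Pi_iff)
  ultimately show ?case by (intro bexI[of _ i']) auto
qed auto

text \<open>The combinatorial core of the parameterization: \<open>E i\<close> stands for the
  exponent of \<open>m i\<close>, and invariance is only a congruence modulo
  \<open>d\<close>.\<close>

locale zero_sum_monomials =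
  fixes n d :: nat and \<alpha> :: "nat \<Rightarrow> nat" and V :: "nat set" and E :: "nat \<Rightarrow> (nat \<Rightarrow>\<^sub>0 nat)"
  assumes d_pos: "d > 0"
    and inj_E: "inj_on E V"
    and E_image: "E ` V = {u. keys u \<subseteq> {0..n} \<and> tdeg u = d \<and> d dvd lin \<alpha> u}"
begin

lemma E_props:
  assumes "i \<in> V"
  shows "keys (E i) \<subseteq> {0..n}" "tdeg (E i) = d" "d dvd lin \<alpha> (E i)"
  using assms E_image by blast+

text \<open>Since \<open>d > 0\<close>, the degree formula forces monomials with equal images to
  have equal degrees.\<close>

lemma lin_E_props:
  assumes "keys t \<subseteq> V"
  shows "keys (lin E t) \<subseteq> {0..n} \<and> tdeg (lin E t) = tdeg t * d \<and> d dvd lin \<alpha> (lin E t)"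
  using assms by (induction t rule: mon_induct) (use E_props in auto)

text \<open>Invariants of degree \<open>k * d\<close> are products of invariants of degree
  \<open>d\<close>: an invariant divisor of degree \<open>d\<close> is split off repeatedly, and the
  cofactor stays invariant.\<close>

lemma obtain_factorization:
  assumes "keys u \<subseteq> {0..n}" "tdeg u = k * d" "d dvd lin \<alpha> u"
  obtains s where "keys s \<subseteq> V" "tdeg s = k" "lin E s = u"
proof -
  have single: "\<exists>i\<in>V. E i = u" if "keys u \<subseteq> {0..n}" "tdeg u = d" "d dvd lin \<alpha> u" for u
  proof -
    have "u \<in> E ` V" using that by (simp add: E_image)
    then show ?thesis by blast
  qed
  have "\<exists>s. keys s \<subseteq> V \<and> tdeg s = k \<and> lin E s = u"
    using assms
  proof (induction k arbitrary: u)
    case 0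
    then show ?case by (intro exI[of _ 0]) (auto simp: tdeg_eq_0_iff)
  next
    case (Suc k)
    obtain r s where rs: "u = r + s" "tdeg r = d" "d dvd lin \<alpha> r" "tdeg s = k * d"
    \<comment> \<open>For the last factor the degree is only \<open>d\<close>, and \<open>u\<close>
      is itself the divisor.\<close>
    proof (cases "k = 0")
      case True
      with that[of u 0] Suc.prems show ?thesis by simp
    next
      case False
      then have "2 * d - 1 \<le> tdeg u" using Suc.prems(2) by (cases k) auto
      then obtain r s where "u = r + s" "tdeg r = d" "d dvd lin \<alpha> r"
        using obtain_zero_sum_divisor d_pos by blast
      with that[of r s] Suc.prems(2) show ?thesis by simp
    qed
    then have "d dvd lin \<alpha> s" using Suc.prems(3) dvd_add_right_iff[of d "lin \<alpha> r"] by simp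
    moreover have "keys r \<subseteq> {0..n}" "keys s \<subseteq> {0..n}" using Suc.prems(1) rs(1) by auto
    ultimately obtain t i where "keys t \<subseteq> V" "tdeg t = k" "lin E t = s" "i \<in> V" "E i = r"
      using Suc.IH[of s] rs(2-4) single[of r] by blast
    then show ?case using rs(1) by (intro exI[of _ "Poly_Mapping.single i 1 + t"]) simp
  qed
  then show thesis using that by blast
qed

text \<open>Along the chain, neighbours share a variable. Cancelling it leaves a binomial of smaller
  degree with equal images, and multiplying back stays in the ideal.\<close>

lemma binomial_in_ideal:
  fixes J :: "'k::comm_ring_1 mvpoly set"
  assumes J: "ideal J (poly_ring V)"
    and base: "\<And>s t. keys s \<subseteq> V \<Longrightarrow> keys t \<subseteq> V \<Longrightarrow> tdeg s = tdeg t \<Longrightarrow> tdeg s \<in> {2, 3} \<Longrightarrow>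
      lin E s = lin E t \<Longrightarrow> mon s - mon t \<in> J"
    and "keys s \<subseteq> V" "keys t \<subseteq> V" "lin E s = lin E t"
  shows "mon s - mon t \<in> J"
  using assms(3-)
proof (induction "tdeg s" arbitrary: s t rule: less_induct)
  case less
  note J_zero = poly_ring_idealD(1)[OF J] and J_add = poly_ring_idealD(2)[OF J]
  have J_mult: "mon u * p \<in> J" if "p \<in> J" "keys u \<subseteq> V" for u p
    using that by (intro poly_ring_idealD(3)[OF J] mon_in_poly_ring)
  have tdeg: "tdeg t = tdeg s"
    using lin_E_props[OF less(2)] lin_E_props[OF less(3)] less(4) d_pos by simp
  consider "tdeg s = 0" | "tdeg s = 1" | "tdeg s \<in> {2, 3}" | "4 \<le> tdeg s" by fastforce
  then show ?case
  proof cases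
    case 1
    then show ?thesis using tdeg J_zero by (simp add: tdeg_eq_0_iff)
  next
    case 2
    have "\<exists>i. u = Poly_Mapping.single i 1" if "tdeg u = 1" for u
      using that nonzero_eq_single_add[of u] by (fastforce simp: tdeg_eq_0_iff)
    then obtain i j where "s = Poly_Mapping.single i 1" "t = Poly_Mapping.single j 1"
      using 2 tdeg by metis
    \<comment> \<open>In degree 1, injectivity of \<open>E\<close> makes the binomial zero.\<close>
    then have "s = t" using less(2-4) inj_E by (auto dest: inj_onD)
    then show ?thesis using J_zero by simp
  next
    case 3
    then show ?thesis using base less(2-4) tdeg by simp
  next
    case 4
    have split: "\<exists>i u'. u = Poly_Mapping.single i 1 + u'" if "tdeg u > 0" for u
      using that nonzero_eq_single_add[of u] by fastforce
    from split[of s] 4 obtain i s' where s: "s = Poly_Mapping.single i 1 + s'" by auto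
    from split[of t] 4 tdeg obtain j t' where t: "t = Poly_Mapping.single j 1 + t'" by auto
    have ij: "i \<in> V" "j \<in> V" and keys': "keys s' \<subseteq> V" "keys t' \<subseteq> V"
      using less(2,3) s t by auto
    have lin_s: "lin E s = E i + lin E s'" and lin_t: "lin E t = E j + lin E t'"
      by (simp_all add: s t)
    have eq: "E i + lin E s' = E j + lin E t'" using less(4) unfolding lin_s lin_t .
    \<comment> \<open>The induction step starts at degree 4: in degree 3 the image has degree
      \<open>3 * d\<close>, below the bound \<open>4 * d - 1\<close> as soon as
      \<open>d > 1\<close>.\<close>
    moreover have "4 * d \<le> tdeg s * d" using 4 by (rule mult_le_mono1)
    then have "4 * d - 1 \<le> tdeg (E i + lin E s')"
      using lin_E_props[OF less(2)] unfolding lin_s by linarith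
    ultimately obtain r x y where rxy: "tdeg r = d" "d dvd lin \<alpha> r"
        "lin E s' = r + x" "lin E t' = r + y"
      using obtain_common_zero_sum_divisor[OF d_pos, of "E i" "lin E s'" "E j" "lin E t'" \<alpha>]
        E_props(2)[OF ij(1)] E_props(2)[OF ij(2)] by blast
    \<comment> \<open>The number of factors left once \<open>i\<close> and the variable mapping to
      \<open>r\<close> are split off.\<close>
    define k where "k = tdeg s - 2"
    have k: "tdeg s = Suc (Suc k)" using 4 by (simp add: k_def)
    have props: "keys z \<subseteq> {0..n} \<and> tdeg z = k * d \<and> d dvd lin \<alpha> z"
      if "lin E v = r + z" "keys v \<subseteq> V" "tdeg v = Suc k" for v z
      using lin_E_props[OF that(2)] rxy(1,2) that(1,3)
        dvd_add_right_iff[of d "lin \<alpha> r" "lin \<alpha> z"] by auto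
    have degs: "tdeg s' = Suc k" "tdeg t' = Suc k" using s t tdeg k by auto
    obtain a where a: "keys a \<subseteq> V" "tdeg a = k" "lin E a = x"
      using obtain_factorization[of x k] props[OF rxy(3) keys'(1) degs(1)] by blast
    obtain b where b: "keys b \<subseteq> V" "tdeg b = k" "lin E b = y"
      using obtain_factorization[of y k] props[OF rxy(4) keys'(2) degs(2)] by blast
    have "r \<in> E ` V"
      using rxy lin_E_props[OF keys'(1)] unfolding E_image by auto
    then obtain c where c: "c \<in> V" "E c = r" by blast
    let ?X = "\<lambda>i. Poly_Mapping.single i (1::nat)"
    \<comment> \<open>The two outer links share the variables \<open>i\<close> and \<open>j\<close>
      respectively.\<close>
    have "mon s' - mon (?X c + a) \<in> J"
      using degs k keys' a c rxy(3) by (intro less(1)) auto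
    then have "mon (?X i) * (mon s' - mon (?X c + a)) \<in> J" using ij by (intro J_mult) auto
    moreover have "mon (?X c + b) - mon t' \<in> J"
      using degs k keys' b c rxy(4) by (intro less(1)) auto
    then have "mon (?X j) * (mon (?X c + b) - mon t') \<in> J" using ij by (intro J_mult) auto
    \<comment> \<open>The middle link shares the variable \<open>c\<close>; cancelling its image
      \<open>r\<close> keeps the images equal.\<close>
    moreover have "E i + x = E j + y"
      using eq rxy(3,4) by (simp add: add.left_commute)
    then have "mon (?X i + a) - mon (?X j + b) \<in> J"
      using k a b ij by (intro less(1)) auto
    then have "mon (?X c) * (mon (?X i + a) - mon (?X j + b)) \<in> J" using c by (intro J_mult) auto
    moreover have "mon s - mon t = mon (?X i) * (mon s' - mon (?X c + a))
        + mon (?X c) * (mon (?X i + a) - mon (?X j + b))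
        + (mon (?X j) * (mon (?X c + b) - mon t') :: 'k mvpoly)"
      unfolding s t mon_add by (simp add: algebra_simps)
    ultimately show ?thesis by (simp only: J_add)
  qed
qed

text \<open>Induction on the number of terms: two terms of \<open>p\<close> have the same image, and
  subtracting a multiple of their binomial removes one of them.\<close>

lemma kernel_in_ideal:
  fixes J :: "'k::comm_ring_1 mvpoly set"
  assumes J: "ideal J (poly_ring V)"
    and binomials: "\<And>s t. keys s \<subseteq> V \<Longrightarrow> keys t \<subseteq> V \<Longrightarrow> lin E s = lin E t \<Longrightarrow> mon s - mon t \<in> J"
    and m: "\<And>i. i \<in> V \<Longrightarrow> m i = mon (E i)"
    and "p \<in> carrier (poly_ring V)" "subst m p = 0"
  shows "p \<in> J"
  using assms(4-)
proof (induction "card (keys p)" arbitrary: p rule: less_induct)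
  case less
  show ?case
  proof (cases "p = 0")
    case True
    then show ?thesis using poly_ring_idealD(1)[OF J] by simp
  next
    case False
    then obtain t where t: "t \<in> keys p" by (meson all_not_in_conv keys_eq_empty)
    have keys: "keys s \<subseteq> V" if "s \<in> keys p" for s using less(2) that by (auto simp: poly_ring_def)
    have subst_m: "subst m (Poly_Mapping.single s c) = Poly_Mapping.single (lin E s) c"
      if "keys s \<subseteq> V" for s c
      using that m by (intro subst_single_mon) auto
    \<comment> \<open>Otherwise nothing cancels the image of the term at \<open>t\<close>, whose
      coefficient is nonzero.\<close>
    have "\<exists>s\<in>keys p. s \<noteq> t \<and> lin E s = lin E t"
    proof (rule ccontr)
      assume neg: "\<not> ?thesis"
      have "subst m p = (\<Sum>s\<in>keys p. Const (lookup p s) * eval_mon m s)"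
        by (rule subst_eq) auto
      also have "\<dots> = (\<Sum>s\<in>keys p. Poly_Mapping.single (lin E s) (lookup p s))"
        using subst_m keys by (intro sum.cong) (auto simp flip: subst_single)
      finally have "lookup (subst m p) (lin E t) =
          (\<Sum>s\<in>keys p. if lin E s = lin E t then lookup p s else 0)"
        by (simp add: lookup_sum lookup_single when_def)
      also have "\<dots> = (\<Sum>s\<in>keys p. if s = t then lookup p s else 0)"
        using neg by (intro sum.cong) auto
      also have "\<dots> = lookup p t" using t by simp
      finally show False using less(3) t by (simp add: in_keys_iff)
    qed
    then obtain s where s: "s \<in> keys p" "s \<noteq> t" "lin E s = lin E t" by blast
    define c where "c = lookup p t"
    \<comment> \<open>The coefficient at \<open>t\<close> is moved to \<open>s\<close>, which
      already occurs in \<open>p\<close>, so no new term arises.\<close>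
    define q where "q = p - Poly_Mapping.single t c + Poly_Mapping.single s c"
    have "keys q \<subseteq> keys p - {t}"
      using s(1,2) by (auto simp: q_def c_def in_keys_iff lookup_add lookup_minus lookup_single when_def
        split: if_splits)
    then have "card (keys q) < card (keys p)" and q: "q \<in> carrier (poly_ring V)"
      using t keys by (auto simp: poly_ring_def intro!: psubset_card_mono)
    moreover have "subst m q = 0"
      using less(3) s t keys by (simp add: q_def subst_add subst_diff subst_m)
    ultimately have "q \<in> J" by (intro less(1))
    moreover have "Const c * (mon t - mon s) \<in> J"
      using binomials keys t s unfolding Const_def
      by (intro poly_ring_idealD(3)[OF J] mon_in_poly_ring) auto
    moreover have "p = q + Const c * (mon t - mon s)"
      by (simp add: q_def right_diff_distrib Const_mult_mon)
    ultimately show ?thesis by (simp only: poly_ring_idealD(2)[OF J])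
  qed
qed

end

section \<open>Generators of the homogeneous ideal of the variety\<close>

theorem theorem3p11:
  fixes n d :: nat
    and e :: "'k::{alg_closed_field, field_char_0}"
    and \<alpha> :: "nat \<Rightarrow> nat"
    and \<mu> :: nat
    and m :: "nat \<Rightarrow> 'k mvpoly"
  assumes "2 \<le> n" and "n < d"
    and "primitive_root_of_unity d e"
    and "mono_on {0..n} \<alpha>" and "\<alpha> n < d"
    and "Gcd (insert d (\<alpha> ` {0..n})) = 1"
    and "\<exists>i\<in>{0..n}. \<exists>j\<in>{0..n}. i \<noteq> j \<and> \<alpha> i < \<alpha> j"
    and "\<mu> = card (invariant_monomials n d e \<alpha>)"
    and "bij_betw m {1..\<mu>} (invariant_monomials n d e \<alpha>)"
  shows "I_X n \<mu> m =
    genideal (poly_ring {1..\<mu>}) (W_binomials \<mu> m 2 \<union> W_binomials \<mu> m 3)"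
proof -
  let ?V = "{1..\<mu>}"
  let ?R = "poly_ring ?V :: 'k mvpoly ring"
  let ?W = "W_binomials \<mu> m 2 \<union> W_binomials \<mu> m 3"
  let ?U = "{u. keys u \<subseteq> {0..n} \<and> tdeg u = d \<and> d dvd lin \<alpha> u}"
  interpret R: cring ?R by (rule cring_poly_ring)
  \<comment> \<open>The exponent of the monomial \<open>m i\<close>, unique because
    \<open>mon\<close> is injective.\<close>
  define E where "E i = (SOME u. m i = mon u)" for i
  have m_image: "m ` ?V = mon ` ?U"
    using assms(9) invariant_monomials_eq[OF assms(3), of n \<alpha>] by (simp add: bij_betw_def)
  have m: "m i = mon (E i)" if "i \<in> ?V" for i
  proof -
    have "\<exists>u. m i = mon u" using m_image that by blast
    then show ?thesis unfolding E_def by (rule someI_ex)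
  qed
  interpret zero_sum_monomials n d \<alpha> ?V E
  proof
    show "d > 0" using assms(3) by (simp add: primitive_root_of_unity_def)
    show "inj_on E ?V"
      using assms(9) m unfolding bij_betw_def inj_on_def by metis
    have "mon ` E ` ?V = (mon ` ?U :: 'k mvpoly set)"
      using m m_image by (simp add: image_image cong: image_cong_simp)
    moreover have "inj (mon :: _ \<Rightarrow> 'k mvpoly)" by (simp add: inj_def)
    ultimately show "E ` ?V = ?U" by (simp add: inj_image_eq_iff)
  qed
  have kernel: "p \<in> I_X n \<mu> m \<longleftrightarrow> p \<in> carrier ?R \<and> subst m p = 0" for p
    by (simp add: I_X_def a_kernel_def kernel_def)
  \<comment> \<open>Needed both for membership in the kernel and for the generated ideal to be an
    ideal containing the binomials.\<close>
  have W_carrier: "W_binomials \<mu> m k \<subseteq> carrier ?R" for k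
  proof
    fix f assume "f \<in> W_binomials \<mu> m k"
    then obtain i j where f: "f = (\<Prod>x=1..k. Var (i x)) - (\<Prod>x=1..k. Var (j x))"
      and ij: "i \<in> {1..k} \<rightarrow> ?V" "j \<in> {1..k} \<rightarrow> ?V"
      by (auto simp: W_binomials_def)
    have "(\<Prod>x=1..k. Var (i x)) \<in> carrier ?R" if "i \<in> {1..k} \<rightarrow> ?V" for i
    proof -
      have "keys (\<Sum>x=1..k. Poly_Mapping.single (i x) (1::nat)) \<subseteq> ?V"
        using that by (auto simp: in_keys_iff lookup_sum lookup_single when_def Pi_iff split: if_splits)
      then show ?thesis using mon_in_poly_ring[of _ ?V "1::'k"] by (simp add: Var_def flip: mon_sum)
    qed
    from R.minus_closed[OF this[OF ij(1)] this[OF ij(2)]] this[OF ij(2)]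
    show "f \<in> carrier ?R" by (simp add: f a_minus_def poly_ring_uminus)
  qed
  have "?W \<subseteq> I_X n \<mu> m"
  proof
    fix f assume W: "f \<in> ?W"
    from W have "subst m f = 0" by (auto simp: W_binomials_def subst_diff subst_prod_Var)
    then show "f \<in> I_X n \<mu> m" using W W_carrier by (auto simp: kernel)
  qed
  then have "genideal ?R ?W \<subseteq> I_X n \<mu> m"
    unfolding I_X_def by (intro R.genideal_minimal ideal_subst_kernel)
  moreover have "I_X n \<mu> m \<subseteq> genideal ?R ?W"
  proof
    fix p assume p: "p \<in> I_X n \<mu> m"
    have J: "ideal (genideal ?R ?W) ?R" using W_carrier by (intro R.genideal_ideal) auto
    have base: "mon s - mon t \<in> genideal ?R ?W"
      if st: "keys s \<subseteq> ?V" "keys t \<subseteq> ?V" "tdeg s = tdeg t" "tdeg s \<in> {2, 3}" "lin E s = lin E t" for s t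
    proof -
      obtain i where i: "i \<in> {1..tdeg s} \<rightarrow> keys s" "mon s = (\<Prod>x=1..tdeg s. Var (i x) :: 'k mvpoly)"
        using mon_eq_prod_Var by blast
      obtain j where j: "j \<in> {1..tdeg s} \<rightarrow> keys t" "mon t = (\<Prod>x=1..tdeg s. Var (j x) :: 'k mvpoly)"
        using mon_eq_prod_Var st(3) by metis
      have "subst m (mon u) = mon (lin E u)" if "keys u \<subseteq> ?V" for u
        using that m by (intro subst_single_mon) auto
      \<comment> \<open>Applying \<open>subst m\<close> to both tuple products turns the equality of
        exponents into the defining condition of \<open>W_binomials\<close>.\<close>
      then have "(\<Prod>x=1..tdeg s. m (i x)) = (\<Prod>x=1..tdeg s. m (j x))"
        using st(1,2,5) subst_prod_Var[of m i "{1..tdeg s}"] subst_prod_Var[of m j "{1..tdeg s}"]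
        unfolding i(2)[symmetric] j(2)[symmetric] by simp
      moreover have "i \<in> {1..tdeg s} \<rightarrow> ?V" "j \<in> {1..tdeg s} \<rightarrow> ?V"
        using i(1) j(1) st(1,2) by auto
      ultimately have "mon s - mon t \<in> W_binomials \<mu> m (tdeg s)"
        unfolding i(2) j(2) W_binomials_def by blast
      then show ?thesis using st(4) R.genideal_self[of ?W] W_carrier by auto
    qed
    show "p \<in> genideal ?R ?W"
      using kernel_in_ideal[OF J binomial_in_ideal[OF J base] m] p kernel by blast
  qed
  ultimately show ?thesis by blast
qed

end
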